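(* Let $A\in\mathbb R^{M_3\times N}$ be the matrix defined in the context. For any given $R\in\mathbb R^{M_3}$, the linear system $AA^\top y=R$ can be solved in $O(M_3)$ flops.
   Context: Let $m,n$ be positive integers, $M=mn$, $M_3=3M-1$, $N=m^2n+mn^2$. $\mathbf 1_p$ is the all-ones vector in $\mathbb R^p$, $I_p$ the identity, $\otimes$ the Kronecker product, and $\bar I_p=[I_{p-1},\mathbf 0_{p-1}]\in\mathbb R^{(p-1)\times p}$. Define $A=\begin{bmatrix} A_1 & A_2 \\ A_3 & \mathbf 0 \\ \mathbf 0 & A_4 \end{bmatrix}\in\mathbb R^{M_3\times N}$ with $A_1=I_M\otimes\mathbf 1_m^\top\in\mathbb R^{M\times m^2n}$, $A_2=-\mathbf 1_n^\top\otimes I_M\in\mathbb R^{M\times mn^2}$, $A_3=I_n\otimes(\mathbf 1_m^\top\otimes I_m)\in\mathbb R^{M\times m^2n}$, and $A_4=\operatorname{diag}(\mathbf 1_n^\top\otimes I_m,\dots,\mathbf 1_n^\top\otimes I_m,\mathbf 1_n^\top\otimes\bar I_m)\in\mathbb R^{(M-1)\times mn^2}$ (block diagonal with $n$ blocks). The matrix $A$ has full row rank. A flop is one elementary arithmetic operation on real numbers; the input is $R$ (together with $m,n$), the matrix $AA^\top$ need not be formed, and the constant in $O(\cdot)$ is absolute (independent of $m,n,R$). *)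

theory Defs
  imports Complex_Main "Jordan_Normal_Form.Matrix"
begin

section \<open>The constraint matrix\<close>

definition kronecker :: "'a::semiring_1 mat \<Rightarrow> 'a mat \<Rightarrow> 'a mat" (infixl \<open>\<otimes>\<^sub>K\<close> 75) where
  "A \<otimes>\<^sub>K B = mat (dim_row A * dim_row B) (dim_col A * dim_col B)
     (\<lambda>(i, j). A $$ (i div dim_row B, j div dim_col B) * B $$ (i mod dim_row B, j mod dim_col B))"

lemma dim_kronecker [simp]:
  "dim_row (A \<otimes>\<^sub>K B) = dim_row A * dim_row B" "dim_col (A \<otimes>\<^sub>K B) = dim_col A * dim_col B"
  by (simp_all add: kronecker_def)

definition ones_row :: "nat \<Rightarrow> real mat" where
  "ones_row p = mat 1 p (\<lambda>_. 1)"

text \<open>The identity matrix of size \<open>p\<close> without its last row.\<close>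

definition I_bar :: "nat \<Rightarrow> real mat" where
  "I_bar p = mat (p - 1) p (\<lambda>(i, j). if i = j then 1 else 0)"

definition A1 :: "nat \<Rightarrow> nat \<Rightarrow> real mat" where
  "A1 m n = 1\<^sub>m (m * n) \<otimes>\<^sub>K ones_row m"

definition A2 :: "nat \<Rightarrow> nat \<Rightarrow> real mat" where
  "A2 m n = (- ones_row n) \<otimes>\<^sub>K 1\<^sub>m (m * n)"

definition A3 :: "nat \<Rightarrow> nat \<Rightarrow> real mat" where
  "A3 m n = 1\<^sub>m n \<otimes>\<^sub>K (ones_row m \<otimes>\<^sub>K 1\<^sub>m m)"

definition A4 :: "nat \<Rightarrow> nat \<Rightarrow> real mat" where
  "A4 m n = diag_block_mat
     (replicate (n - 1) (ones_row n \<otimes>\<^sub>K 1\<^sub>m m) @ [ones_row n \<otimes>\<^sub>K I_bar m])"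

definition M3 :: "nat \<Rightarrow> nat \<Rightarrow> nat" where
  "M3 m n = 3 * (m * n) - 1"

definition A_mat :: "nat \<Rightarrow> nat \<Rightarrow> real mat" where
  "A_mat m n = four_block_mat
     (A1 m n)                                   (A2 m n)
     (A3 m n @\<^sub>r 0\<^sub>m (m * n - 1) (m^2 * n))     (0\<^sub>m (m * n) (m * n^2) @\<^sub>r A4 m n)"

lemma A_mat_carrier:
  assumes "0 < m" "0 < n"
  shows "A_mat m n \<in> carrier_mat (M3 m n) (m^2 * n + m * n^2)"
proof -
  have A1: "A1 m n \<in> carrier_mat (m * n) (m^2 * n)"
    by (rule carrier_matI) (simp_all add: A1_def ones_row_def power2_eq_square)
  have A3: "A3 m n \<in> carrier_mat (m * n) (m^2 * n)"
    by (rule carrier_matI) (simp_all add: A3_def ones_row_def power2_eq_square)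
  obtain a b where ab: "m = Suc a" "n = Suc b"
    using assms by (metis gr0_implies_Suc)
  have A4: "A4 m n \<in> carrier_mat (m * n - 1) (m * n^2)"
    unfolding ab by (rule carrier_matI)
      (simp_all add: A4_def dim_diag_block_mat ones_row_def I_bar_def sum_list_replicate
        power2_eq_square algebra_simps)
  have dims: "m * n + (m * n + (m * n - 1)) = M3 m n"
    using assms by (simp add: M3_def)
  show ?thesis
    unfolding A_mat_def dims[symmetric]
    by (intro four_block_carrier_mat carrier_append_rows A1 A4 zero_carrier_mat)
qed

section \<open>Algorithms and flop counts\<close>

text \<open>
  Algorithms are programs of a small imperative language on arrays of real numbers. A single
  program has to work for all sizes \<open>m\<close> and \<open>n\<close>; these are available to the index
  arithmetic as the index variables \<open>0\<close> and \<open>1\<close>, and as the real numbers stored in the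
  array \<open>Sizes\<close>. Array indices and loop bounds are polynomial expressions in \<open>m\<close>, \<open>n\<close> and the
  loop counters. They cannot depend on real data and cannot be turned into real numbers, so every
  real number other than the inputs and the fixed literals in the program text is obtained by
  flops.
\<close>

datatype index_exp =
    INum nat
  | IVar nat
  | IAdd index_exp index_exp
  | ISub index_exp index_exp
  | IMul index_exp index_exp

primrec ieval :: "index_exp \<Rightarrow> (nat \<Rightarrow> nat) \<Rightarrow> nat" where
  "ieval (INum k) \<rho> = k"
| "ieval (IVar v) \<rho> = \<rho> v"
| "ieval (IAdd e f) \<rho> = ieval e \<rho> + ieval f \<rho>"
| "ieval (ISub e f) \<rho> = ieval e \<rho> - ieval f \<rho>"
| "ieval (IMul e f) \<rho> = ieval e \<rho> * ieval f \<rho>"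

datatype array = Input | Sizes | Output | Work nat

datatype cell = Cell array index_exp

datatype arith = Add | Sub | Mul | Div

datatype prog =
    Literal cell nat
  | Move cell cell
  | Arith cell arith cell cell
  | Seq prog prog
  | For nat index_exp prog

type_synonym memory = "array \<Rightarrow> nat \<Rightarrow> real"

primrec get :: "cell \<Rightarrow> (nat \<Rightarrow> nat) \<Rightarrow> memory \<Rightarrow> real" where
  "get (Cell a e) \<rho> \<mu> = \<mu> a (ieval e \<rho>)"

primrec put :: "cell \<Rightarrow> real \<Rightarrow> (nat \<Rightarrow> nat) \<Rightarrow> memory \<Rightarrow> memory" where
  "put (Cell a e) x \<rho> \<mu> = \<mu>(a := (\<mu> a)(ieval e \<rho> := x))"

text \<open>Division by zero is an error, in spite of the convention \<open>x / 0 = 0\<close> for real numbers.\<close>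

fun arith_op :: "arith \<Rightarrow> real \<Rightarrow> real \<Rightarrow> real option" where
  "arith_op Add x y = Some (x + y)"
| "arith_op Sub x y = Some (x - y)"
| "arith_op Mul x y = Some (x * y)"
| "arith_op Div x y = (if y = 0 then None else Some (x / y))"

primrec iterate :: "(nat \<Rightarrow> 's \<Rightarrow> 's option) \<Rightarrow> nat \<Rightarrow> 's \<Rightarrow> 's option" where
  "iterate f 0 s = Some s"
| "iterate f (Suc k) s = Option.bind (iterate f k s) (f k)"

text \<open>
  The second component of the state counts the arithmetic operations on real numbers performed so
  far. Moving data, loading a literal and index arithmetic are not flops. \<open>For v e p\<close>
  runs \<open>p\<close> with the index variable \<open>v\<close> bound to each number below the value of \<open>e\<close>, in increasing
  order.
\<close>

primrec exec :: "prog \<Rightarrow> (nat \<Rightarrow> nat) \<Rightarrow> memory \<times> nat \<Rightarrow> (memory \<times> nat) option" where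
  "exec (Literal c k) \<rho> s = Some (put c (real k) \<rho> (fst s), snd s)"
| "exec (Move c d) \<rho> s = Some (put c (get d \<rho> (fst s)) \<rho> (fst s), snd s)"
| "exec (Arith c f d e) \<rho> s =
     map_option (\<lambda>x. (put c x \<rho> (fst s), snd s + 1))
       (arith_op f (get d \<rho> (fst s)) (get e \<rho> (fst s)))"
| "exec (Seq p q) \<rho> s = Option.bind (exec p \<rho> s) (exec q \<rho>)"
| "exec (For v e p) \<rho> s = iterate (\<lambda>i. exec p (\<rho>(v := i))) (ieval e \<rho>) s"

definition init_index :: "nat \<Rightarrow> nat \<Rightarrow> nat \<Rightarrow> nat" where
  "init_index m n = (\<lambda>_. 0)(0 := m, 1 := n)"

definition init_memory :: "nat \<Rightarrow> nat \<Rightarrow> real vec \<Rightarrow> memory" where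
  "init_memory m n R = (\<lambda>_ _. 0)
     (Input := (\<lambda>i. if i < dim_vec R then R $ i else 0),
      Sizes := (\<lambda>_. 0)(0 := real m, 1 := real n))"

text \<open>
  \<open>computes p m n R y k\<close>: started on the data \<open>m\<close>, \<open>n\<close>, \<open>R\<close>, the program \<open>p\<close> terminates
  without error after exactly \<open>k\<close> flops, with \<open>y\<close> as the leading part of the output array.
\<close>

definition computes ::
  "prog \<Rightarrow> nat \<Rightarrow> nat \<Rightarrow> real vec \<Rightarrow> real vec \<Rightarrow> nat \<Rightarrow> bool" where
  "computes p m n R y k \<longleftrightarrow>
     (\<exists>\<mu>. exec p (init_index m n) (init_memory m n R, 0) = Some (\<mu>, k) \<and>
          (\<forall>i < dim_vec y. y $ i = \<mu> Output i))"

end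

theory Submission
  imports Defs
begin

text \<open>
  Write \<open>y = (u, v, w)\<close>, where each part is an \<open>n \<times> m\<close> grid of numbers and the corner
  \<open>w (n - 1) (m - 1)\<close> is replaced by \<open>0\<close>. The first \<open>m\<^sup>2 n\<close> entries of the transpose of \<open>A\<close>
  applied to \<open>y\<close> are the sums \<open>u k i + v k j\<close>, the others are the differences \<open>w l i - u s i\<close>. Hence
  the second and third block of equations express \<open>v\<close> and \<open>w\<close> through the row sums \<open>U k\<close> and the
  column sums \<open>T i\<close> of \<open>u\<close>, and the first block becomes
  \<open>(m + n) u k i = b k i + U k + E i\<close>, with \<open>E i = T i\<close> except in the last column, where the
  missing equation gives \<open>E i = T i - T i / n\<close>. Summing over rows and over columns expresses \<open>U\<close>
  and \<open>T\<close> through the sum \<open>S\<close> of all entries of \<open>u\<close>, and summing once more determines \<open>S\<close>.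
  Each quantity is an average or a sum over the grid, so all of them take \<open>O(mn)\<close> operations.
\<close>

section \<open>Solution of the linear system\<close>

lemma sum_split_last:
  fixes f :: "nat \<Rightarrow> real"
  assumes "0 < k"
  shows "(\<Sum>i<k. f i) = (\<Sum>i<k - 1. f i) + f (k - 1)"
  using assms by (cases k) simp_all

text \<open>
  The third block of equations has no equation at the corner \<open>(n - 1, m - 1)\<close>. The right-hand side
  is extended by \<open>0\<close> there, as in the cell of \<open>Input\<close> that follows the given data.
\<close>

locale grid_system =
  fixes m n :: nat and r\<^sub>1 r\<^sub>2 r\<^sub>3 :: "nat \<Rightarrow> nat \<Rightarrow> real"
  assumes m_pos: "0 < m" and n_pos: "0 < n" and corner: "r\<^sub>3 (n - 1) (m - 1) = 0"
begin

text \<open>\<open>P\<close> and \<open>Q\<close> are the constant parts of the row sums of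
  \<open>v\<close> and the column sums of \<open>w\<close>, which are \<open>P k - U k\<close> and
  \<open>Q i + T i\<close>. Substituting these into the first block leaves a system for
  \<open>u\<close> alone with right-hand side \<open>b\<close>.\<close>

definition P :: "nat \<Rightarrow> real" where "P k = (\<Sum>i<m. r\<^sub>2 k i) / m"
definition Q :: "nat \<Rightarrow> real" where "Q i = (\<Sum>k<n. r\<^sub>3 k i) / n"
definition b :: "nat \<Rightarrow> nat \<Rightarrow> real" where "b k i = r\<^sub>1 k i - P k + Q i"
definition b_col :: "nat \<Rightarrow> real" where "b_col i = (\<Sum>k<n. b k i)"
definition b_row :: "nat \<Rightarrow> real" where "b_row k = (\<Sum>i<m. b k i)"
definition total :: real where "total = (\<Sum>i<m. b_col i)"
text \<open>Eliminating \<open>E\<close> from the column sums of \<open>u\<close> gives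
  \<open>m * T i = b_col i + S\<close>, with an extra \<open>T (m - 1)\<close> on the left in the
  last column. Summed over all columns, \<open>m * S\<close> cancels and
  \<open>T (m - 1) = total\<close> remains; the last column then yields \<open>S\<close>.\<close>

definition S :: real where "S = (1 + m) * total - b_col (m - 1)"

text \<open>Summing column \<open>m - 1\<close> gives \<open>(m + 1) T (m - 1) = b_col (m - 1) + S = (m + 1) total\<close>.\<close>

definition T :: "nat \<Rightarrow> real" where "T i = (if i = m - 1 then total else (b_col i + S) / m)"

text \<open>This is the value that the formula for \<open>w\<close> takes at the missing corner,
  where \<open>r\<^sub>3\<close> is \<open>0\<close>; the first block lacks it in the last
  column.\<close>

definition D :: real where "D = total / n"
definition E :: "nat \<Rightarrow> real" where "E i = (if i = m - 1 then total - D else T i)"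
definition U :: "nat \<Rightarrow> real" where "U k = (b_row k + (S - D)) / n"
definition u :: "nat \<Rightarrow> nat \<Rightarrow> real" where "u k i = (b k i + U k + E i) / (real m + n)"
definition v :: "nat \<Rightarrow> nat \<Rightarrow> real" where "v k i = (r\<^sub>2 k i - U k) / m"
definition w :: "nat \<Rightarrow> nat \<Rightarrow> real" where "w k i = (r\<^sub>3 k i + T i) / n"

text \<open>\<open>S\<close>, \<open>T\<close> and \<open>U\<close> are defined by closed formulas,
  before \<open>u\<close>. That they are the total, the column sums and the row sums of
  \<open>u\<close> must therefore be verified, beginning with the sum of the
  \<open>T i\<close>.\<close>

lemma sum_T: "(\<Sum>i<m. T i) = S"
proof -
  have "(\<Sum>i<m. T i) = (\<Sum>i<m - 1. (b_col i + S) / m) + total"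
    unfolding sum_split_last[OF m_pos] by (simp add: T_def)
  also have "\<dots> = ((\<Sum>i<m - 1. b_col i) + (real m - 1) * S) / m + total"
    using m_pos by (simp flip: sum_divide_distrib add: sum.distrib of_nat_diff)
  also have "(\<Sum>i<m - 1. b_col i) = total - b_col (m - 1)"
    unfolding total_def sum_split_last[OF m_pos] by simp
  also have "(total - b_col (m - 1) + (real m - 1) * S) / m + total = S"
    using m_pos by (simp add: S_def field_simps)
  finally show ?thesis .
qed

lemma sum_E: "(\<Sum>i<m. E i) = S - D"
  using sum_T unfolding sum_split_last[OF m_pos] by (simp add: E_def T_def)

lemma sum_b_row: "(\<Sum>k<n. b_row k) = total"
  unfolding b_row_def total_def b_col_def by (rule sum.swap)

lemma n_D: "n * D = total"
  using n_pos by (simp add: D_def)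

lemma sum_U: "(\<Sum>k<n. U k) = S"
proof -
  have "(\<Sum>k<n. U k) = (total + n * (S - D)) / n"
    by (simp flip: sum_divide_distrib add: U_def sum.distrib sum_b_row)
  also have "\<dots> = S"
    using n_pos n_D by (simp add: field_simps)
  finally show ?thesis .
qed

text \<open>Summing the numerators of \<open>u k i\<close> over \<open>i\<close> gives
  \<open>b_row k + m * U k + (S - D)\<close>, and \<open>n * U k = b_row k + (S - D)\<close> by
  definition of \<open>U\<close>.\<close>

lemma sum_u_row: "(\<Sum>i<m. u k i) = U k"
proof -
  have "(\<Sum>i<m. u k i) = (n * U k + m * U k) / (real m + n)"
    using n_pos by (simp flip: sum_divide_distrib b_row_def
        add: u_def sum.distrib sum_E) (simp add: U_def)
  also have "\<dots> = U k"
    using m_pos by (simp add: field_simps)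
  finally show ?thesis .
qed

lemma sum_u_col: "(\<Sum>k<n. u k i) = T i"
proof -
  \<comment> \<open>The left side is the sum over \<open>k\<close> of the numerators of
    \<open>u k i\<close>. In the last column \<open>n * E i = n * total - total\<close>.\<close>
  have "b_col i + S + n * E i = (real m + n) * T i"
  proof (cases "i = m - 1")
    case True
    then show ?thesis
      using n_D by (simp add: E_def T_def S_def algebra_simps)
  next
    case False
    then have "m * T i = b_col i + S" "E i = T i"
      using m_pos by (simp_all add: T_def E_def)
    then show ?thesis by (simp add: algebra_simps)
  qed
  then show ?thesis
    using m_pos by (simp flip: sum_divide_distrib b_col_def
        add: u_def sum.distrib sum_U field_simps)
qed

section \<open>The three blocks of equations\<close>

lemma equation_2: "(\<Sum>i<m. u k i + v k j) = r\<^sub>2 k j"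
  using m_pos by (simp add: sum.distrib sum_u_row v_def)

lemma equation_3: "(\<Sum>s<n. w k i - u s i) = r\<^sub>3 k i"
  using n_pos by (simp add: sum_subtractf sum_u_col w_def)

lemma equation_1:
  assumes "i < m"
  shows "(\<Sum>j<m. u k i + v k j) - (\<Sum>l<n. (if l = n - 1 \<and> i = m - 1 then 0 else w l i) - u k i)
    = r\<^sub>1 k i"
proof -
  have v: "(\<Sum>j<m. v k j) = P k - U k"
    using m_pos by (simp flip: sum_divide_distrib add: v_def sum_subtractf P_def field_simps)
  have w: "(\<Sum>l<n. w l i) = Q i + T i"
    using n_pos by (simp flip: sum_divide_distrib add: w_def sum.distrib Q_def field_simps)
  have "(\<Sum>l<n. if l = n - 1 \<and> i = m - 1 then 0 else w l i) = Q i + E i"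
  proof (cases "i = m - 1")
    case True
    \<comment> \<open>By \<open>corner\<close>, the dropped term \<open>w (n - 1) i\<close> equals
      \<open>T i / n = D\<close>, which is the difference between \<open>T i\<close> and
      \<open>E i\<close>.\<close>
    have "(\<Sum>l<n. if l = n - 1 \<and> i = m - 1 then 0 else w l i) = (\<Sum>l<n. w l i) - w (n - 1) i"
      unfolding sum_split_last[OF n_pos] using True by simp
    then show ?thesis
      using True corner unfolding w by (simp add: w_def E_def T_def D_def)
  next
    case False
    then show ?thesis by (simp add: w E_def)
  qed
  moreover have "(real m + n) * u k i = b k i + U k + E i"
    using m_pos by (simp add: u_def)
  ultimately show ?thesis
    by (simp add: sum.distrib sum_subtractf v b_def algebra_simps)
qed

end

section \<open>The program\<close>

abbreviation overwrite :: "array \<Rightarrow> (nat \<Rightarrow> real) \<Rightarrow> nat set \<Rightarrow> memory \<Rightarrow> memory" where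
  "overwrite a h X \<mu> \<equiv> \<mu>(a := override_on (\<mu> a) h X)"

text \<open>The initial counter is arbitrary, so that the costs of consecutive programs add
  up.\<close>

definition runs :: "prog \<Rightarrow> (nat \<Rightarrow> nat) \<Rightarrow> memory \<Rightarrow> memory \<Rightarrow> nat \<Rightarrow> bool" where
  "runs p \<rho> \<mu> \<mu>' c \<longleftrightarrow> (\<forall>k. exec p \<rho> (\<mu>, k) = Some (\<mu>', k + c))"

lemma runs_Seq:
  assumes "runs p \<rho> \<mu> \<mu>' c" "runs q \<rho> \<mu>' \<mu>'' d"
  shows "runs (Seq p q) \<rho> \<mu> \<mu>'' (c + d)"
  using assms by (simp add: runs_def add.assoc)

lemma overwrite_apply: "overwrite a h X \<mu> c x = (if c = a \<and> x \<in> X then h x else \<mu> c x)"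
  by (simp add: override_on_def)

lemma override_on_override_on:
  "override_on (override_on f h X) h Y = override_on f h (X \<union> Y)"
  by (auto simp: override_on_def)

text \<open>All iterations write values of one function \<open>h\<close>, so their combined effect
  is determined by the union of the sets \<open>X i\<close>. The body must behave this way for any
  contents of \<open>a\<close>: no iteration may rely on what an earlier one wrote.\<close>

lemma runs_For:
  assumes body: "\<And>i \<mu>'. i < N \<Longrightarrow> (\<And>a'. a' \<noteq> a \<Longrightarrow> \<mu>' a' = \<mu> a') \<Longrightarrow>
      runs p (\<rho>(x := i)) \<mu>' (overwrite a h (X i) \<mu>') c"
    and "ieval e \<rho> = N" "Y = (\<Union>i<N. X i)" "d = N * c"
  shows "runs (For x e p) \<rho> \<mu> (overwrite a h Y \<mu>) d"
proof -
  have "iterate (\<lambda>i. exec p (\<rho>(x := i))) K (\<mu>, k) =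
      Some (overwrite a h (\<Union>i<K. X i) \<mu>, k + K * c)" if "K \<le> N" for K k
    using that
  proof (induction K)
    case (Suc K)
    let ?\<mu>' = "overwrite a h (\<Union>i<K. X i) \<mu>"
    have "runs p (\<rho>(x := K)) ?\<mu>' (overwrite a h (X K) ?\<mu>') c"
      using Suc.prems by (intro body) simp_all
    moreover have "overwrite a h (X K) ?\<mu>' = overwrite a h (\<Union>i<Suc K. X i) \<mu>"
      by (simp add: override_on_override_on lessThan_Suc Un_commute)
    ultimately have "exec p (\<rho>(x := K)) (?\<mu>', k + K * c) =
        Some (overwrite a h (\<Union>i<Suc K. X i) \<mu>, k + K * c + c)"
      by (simp only: runs_def)
    then show ?case
      using Suc by (simp del: fun_upd_apply)
  qed simp
  then show ?thesis
    using assms(2-) by (simp add: runs_def)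
qed

definition accumulate :: "array \<Rightarrow> index_exp \<Rightarrow> nat \<Rightarrow> index_exp \<Rightarrow> cell \<Rightarrow> prog" where
  "accumulate a f x e d =
     Seq (Literal (Cell a f) 0) (For x e (Arith (Cell a f) Add (Cell a f) d))"

text \<open>Every iteration reads the partial sum left by the previous one, so
  \<open>runs_For\<close> does not fit and a separate induction is used. Adding the first summand to
  the literal \<open>0\<close> is counted as a flop.\<close>

lemma exec_accumulate [simp]:
  assumes "a \<noteq> a'" "\<And>i. ieval f (\<rho>(x := i)) = ieval f \<rho>"
  shows "exec (accumulate a f x e (Cell a' g)) \<rho> (\<mu>, k) =
    Some (\<mu>(a := (\<mu> a)(ieval f \<rho> := \<Sum>i<ieval e \<rho>. \<mu> a' (ieval g (\<rho>(x := i))))), k + ieval e \<rho>)"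
proof -
  have "iterate (\<lambda>i. exec (Arith (Cell a f) Add (Cell a f) (Cell a' g)) (\<rho>(x := i))) N
      (\<mu>(a := (\<mu> a)(ieval f \<rho> := 0)), k) =
      Some (\<mu>(a := (\<mu> a)(ieval f \<rho> := \<Sum>i<N. \<mu> a' (ieval g (\<rho>(x := i))))), k + N)" for N
    using assms by (induction N) simp_all
  then show ?thesis by (simp add: accumulate_def)
qed

text \<open>Index variables \<open>2\<close> and \<open>3\<close> hold the row and the column of a position in the grid.\<close>

abbreviation "grid_row \<equiv> IVar 2"
abbreviation "grid_col \<equiv> IVar 3"
abbreviation "pos \<equiv> IAdd (IMul grid_row (IVar 0)) grid_col"
abbreviation "grid_size \<equiv> IMul (IVar 0) (IVar 1)"
abbreviation "pos\<^sub>2 \<equiv> IAdd grid_size pos"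
abbreviation "pos\<^sub>3 \<equiv> IAdd (IMul (INum 2) grid_size) pos"
abbreviation "last_col \<equiv> ISub (IVar 0) (INum 1)"
abbreviation "size_m \<equiv> Cell Sizes (INum 0)"
abbreviation "size_n \<equiv> Cell Sizes (INum 1)"
abbreviation "scalar j \<equiv> Cell (Work j) (INum 0)"

definition for_rows :: "prog \<Rightarrow> prog" where "for_rows = For 2 (IVar 1)"
definition for_cols :: "prog \<Rightarrow> prog" where "for_cols = For 3 (IVar 0)"
definition for_grid :: "prog \<Rightarrow> prog" where "for_grid p = for_rows (for_cols p)"

lemma runs_for_rows:
  assumes "\<And>k \<mu>'. k < n \<Longrightarrow> (\<And>a'. a' \<noteq> a \<Longrightarrow> \<mu>' a' = \<mu> a') \<Longrightarrow>
      runs p ((init_index m n)(2 := k)) \<mu>' (overwrite a h {k} \<mu>') c"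
  shows "runs (for_rows p) (init_index m n) \<mu> (overwrite a h {..<n} \<mu>) (n * c)"
  unfolding for_rows_def
  by (rule runs_For[where X = "\<lambda>k. {k}" and N = n and c = c])
    (simp_all add: assms, simp_all add: init_index_def)

lemma runs_for_cols:
  assumes "\<And>i \<mu>'. i < m \<Longrightarrow> (\<And>a'. a' \<noteq> a \<Longrightarrow> \<mu>' a' = \<mu> a') \<Longrightarrow>
      runs p ((init_index m n)(3 := i)) \<mu>' (overwrite a h {i} \<mu>') c"
  shows "runs (for_cols p) (init_index m n) \<mu> (overwrite a h {..<m} \<mu>) (m * c)"
  unfolding for_cols_def
  by (rule runs_For[where X = "\<lambda>i. {i}" and N = m and c = c])
    (simp_all add: assms, simp_all add: init_index_def)

lemma UN_singleton_lessThan: "(\<Union>i<m. {l + i}) = {l..<l + m :: nat}"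
  using image_add_atLeastLessThan[of l 0 m] by (auto simp: atLeast0LessThan image_iff)

lemma UN_blocks: "(\<Union>k<n. {l + k * m..<l + k * m + m}) = {l..<l + n * m :: nat}"
  by (induction n) (auto simp: lessThan_Suc)

text \<open>The offset \<open>l\<close> selects one of the three grids stored one after the other;
  in row-major order successive rows fill adjacent intervals.\<close>

lemma runs_for_grid:
  assumes "\<And>k i \<mu>'. k < n \<Longrightarrow> i < m \<Longrightarrow> (\<And>a'. a' \<noteq> a \<Longrightarrow> \<mu>' a' = \<mu> a') \<Longrightarrow>
      runs p ((init_index m n)(2 := k, 3 := i)) \<mu>' (overwrite a h {l + (k * m + i)} \<mu>') c"
  shows "runs (for_grid p) (init_index m n) \<mu> (overwrite a h {l..<l + n * m} \<mu>) (n * (m * c))"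
  unfolding for_grid_def for_rows_def for_cols_def
proof (rule runs_For[where X = "\<lambda>k. {l + k * m..<l + k * m + m}"])
  fix k \<mu>' assume k: "k < n" and \<mu>': "\<And>a'. a' \<noteq> a \<Longrightarrow> \<mu>' a' = \<mu> a'"
  show "runs (For 3 (IVar 0) p) ((init_index m n)(2 := k)) \<mu>'
      (overwrite a h {l + k * m..<l + k * m + m} \<mu>') (m * c)"
    by (rule runs_For[where X = "\<lambda>i. {l + (k * m + i)}" and N = m and c = c])
      (use UN_singleton_lessThan[of "l + k * m" m] in
        \<open>simp_all add: assms k \<mu>' add.assoc, simp_all add: init_index_def\<close>)
qed (simp_all add: init_index_def UN_blocks)

lemma block_pos_less:
  fixes k n i m :: nat
  assumes "k < n" "i < m"
  shows "k * m + i < n * m"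
proof -
  have "k * m + i < Suc k * m"
    using assms by simp
  also have "\<dots> \<le> n * m"
    using assms by (intro mult_le_mono1) simp
  finally show ?thesis .
qed

definition flat :: "nat \<Rightarrow> (nat \<Rightarrow> nat \<Rightarrow> real) \<Rightarrow> nat \<Rightarrow> real" where
  "flat m f x = f (x div m) (x mod m)"

lemma flat_pos [simp]: "i < m \<Longrightarrow> flat m f (k * m + i) = f k i"
  by (simp add: flat_def)

section \<open>One phase per quantity of the solution; \<open>Work j\<close> belongs to phase
  \<open>j\<close>, counted from \<open>0\<close>\<close>

definition prog_P :: prog where
  "prog_P = for_rows (Seq
     (accumulate (Work 0) grid_row 3 (IVar 0) (Cell Input pos\<^sub>2))
     (Arith (Cell (Work 0) grid_row) Div (Cell (Work 0) grid_row) size_m))"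

definition prog_Q :: prog where
  "prog_Q = for_cols (Seq
     (accumulate (Work 1) grid_col 2 (IVar 1) (Cell Input pos\<^sub>3))
     (Arith (Cell (Work 1) grid_col) Div (Cell (Work 1) grid_col) size_n))"

definition prog_b :: prog where
  "prog_b = for_grid (Seq
     (Arith (Cell (Work 2) pos) Sub (Cell Input pos) (Cell (Work 0) grid_row))
     (Arith (Cell (Work 2) pos) Add (Cell (Work 2) pos) (Cell (Work 1) grid_col)))"

definition prog_b_col :: prog where
  "prog_b_col = for_cols (accumulate (Work 3) grid_col 2 (IVar 1) (Cell (Work 2) pos))"

definition prog_b_row :: prog where
  "prog_b_row = for_rows (accumulate (Work 4) grid_row 3 (IVar 0) (Cell (Work 2) pos))"

definition prog_total :: prog where
  "prog_total = accumulate (Work 5) (INum 0) 3 (IVar 0) (Cell (Work 3) grid_col)"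

text \<open>Index variables cannot become real numbers, so \<open>1 + m\<close> is built from a
  literal and an entry of \<open>Sizes\<close>.\<close>

definition prog_S :: prog where
  "prog_S = Seq (Literal (scalar 6) 1)
     (Seq (Arith (scalar 6) Add (scalar 6) size_m)
     (Seq (Arith (scalar 6) Mul (scalar 6) (scalar 5))
          (Arith (scalar 6) Sub (scalar 6) (Cell (Work 3) last_col))))"

text \<open>The language has no conditional: the loop applies the generic formula in every column,
  and the last entry is overwritten afterwards. \<open>prog_E\<close> does the same.\<close>

definition prog_T :: prog where
  "prog_T = Seq (for_cols (Seq
     (Arith (Cell (Work 7) grid_col) Add (Cell (Work 3) grid_col) (scalar 6))
     (Arith (Cell (Work 7) grid_col) Div (Cell (Work 7) grid_col) size_m)))
     (Move (Cell (Work 7) last_col) (scalar 5))"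

definition prog_D :: prog where
  "prog_D = Arith (scalar 8) Div (scalar 5) size_n"

definition prog_E :: prog where
  "prog_E = Seq (for_cols (Move (Cell (Work 9) grid_col) (Cell (Work 7) grid_col)))
     (Arith (Cell (Work 9) last_col) Sub (scalar 5) (scalar 8))"

definition prog_U :: prog where
  "prog_U = for_rows (Seq
     (Arith (Cell (Work 10) grid_row) Sub (scalar 6) (scalar 8))
     (Seq (Arith (Cell (Work 10) grid_row) Add (Cell (Work 4) grid_row) (Cell (Work 10) grid_row))
          (Arith (Cell (Work 10) grid_row) Div (Cell (Work 10) grid_row) size_n)))"

definition prog_mn :: prog where
  "prog_mn = Arith (scalar 11) Add size_m size_n"

definition prog_u :: prog where
  "prog_u = for_grid (Seq
     (Arith (Cell Output pos) Add (Cell (Work 2) pos) (Cell (Work 10) grid_row))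
     (Seq (Arith (Cell Output pos) Add (Cell Output pos) (Cell (Work 9) grid_col))
          (Arith (Cell Output pos) Div (Cell Output pos) (scalar 11))))"

definition prog_v :: prog where
  "prog_v = for_grid (Seq
     (Arith (Cell Output pos\<^sub>2) Sub (Cell Input pos\<^sub>2) (Cell (Work 10) grid_row))
     (Arith (Cell Output pos\<^sub>2) Div (Cell Output pos\<^sub>2) size_m))"

text \<open>The whole grid is written, including the corner, whose cell lies just past the
  \<open>M3 m n\<close> entries of the solution.\<close>

definition prog_w :: prog where
  "prog_w = for_grid (Seq
     (Arith (Cell Output pos\<^sub>3) Add (Cell Input pos\<^sub>3) (Cell (Work 7) grid_col))
     (Arith (Cell Output pos\<^sub>3) Div (Cell Output pos\<^sub>3) size_n))"

section \<open>Correctness and cost of the phases\<close>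

context grid_system
begin

text \<open>Division by zero makes \<open>exec\<close> fail, so \<open>m_pos\<close> is what lets
  the averaging succeed; the phases that divide by \<open>n\<close> use \<open>n_pos\<close> in the
  same way.\<close>

lemma runs_P:
  assumes "\<And>k i. k < n \<Longrightarrow> i < m \<Longrightarrow> \<mu> Input (m * n + (k * m + i)) = r\<^sub>2 k i" "\<mu> Sizes 0 = real m"
  shows "runs prog_P (init_index m n) \<mu> (overwrite (Work 0) P {..<n} \<mu>) (n * (m + 1))"
  unfolding prog_P_def
  by (rule runs_for_rows)
    (use m_pos in \<open>simp add: runs_def init_index_def override_on_insert assms P_def\<close>)

lemma runs_Q:
  assumes "\<And>k i. k < n \<Longrightarrow> i < m \<Longrightarrow> \<mu> Input (2 * (m * n) + (k * m + i)) = r\<^sub>3 k i"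
    "\<mu> Sizes 1 = real n"
  shows "runs prog_Q (init_index m n) \<mu> (overwrite (Work 1) Q {..<m} \<mu>) (m * (n + 1))"
  unfolding prog_Q_def
  by (rule runs_for_cols)
    (use n_pos assms(2) in \<open>simp add: runs_def init_index_def override_on_insert assms(1) Q_def\<close>)

text \<open>The interval \<open>{0..<0 + n * m}\<close> is the instance \<open>l = 0\<close> of
  \<open>runs_for_grid\<close>, left in that form to match the rule.\<close>

lemma runs_b:
  assumes "\<And>k i. k < n \<Longrightarrow> i < m \<Longrightarrow> \<mu> Input (k * m + i) = r\<^sub>1 k i"
    "\<And>k. k < n \<Longrightarrow> \<mu> (Work 0) k = P k"
    "\<And>i. i < m \<Longrightarrow> \<mu> (Work 1) i = Q i"
  shows "runs prog_b (init_index m n) \<mu> (overwrite (Work 2) (flat m b) {0..<0 + n * m} \<mu>) (n * (m * 2))"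
  unfolding prog_b_def
  by (rule runs_for_grid)
    (use assms(3) in \<open>simp add: runs_def init_index_def override_on_insert assms(1,2) b_def\<close>)

lemma runs_b_col:
  assumes "\<And>k i. k < n \<Longrightarrow> i < m \<Longrightarrow> \<mu> (Work 2) (k * m + i) = b k i"
  shows "runs prog_b_col (init_index m n) \<mu> (overwrite (Work 3) b_col {..<m} \<mu>) (m * n)"
  unfolding prog_b_col_def
  by (rule runs_for_cols) (simp add: runs_def init_index_def override_on_insert assms b_col_def)

lemma runs_b_row:
  assumes "\<And>k i. k < n \<Longrightarrow> i < m \<Longrightarrow> \<mu> (Work 2) (k * m + i) = b k i"
  shows "runs prog_b_row (init_index m n) \<mu> (overwrite (Work 4) b_row {..<n} \<mu>) (n * m)"
  unfolding prog_b_row_def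
  by (rule runs_for_rows) (simp add: runs_def init_index_def override_on_insert assms b_row_def)

lemma runs_total:
  assumes "\<And>i. i < m \<Longrightarrow> \<mu> (Work 3) i = b_col i"
  shows "runs prog_total (init_index m n) \<mu> (overwrite (Work 5) (\<lambda>_. total) {0} \<mu>) m"
  by (simp add: runs_def prog_total_def init_index_def override_on_insert assms total_def)

lemma runs_S:
  assumes "\<mu> Sizes 0 = real m" "\<mu> (Work 3) (m - 1) = b_col (m - 1)" "\<mu> (Work 5) 0 = total"
  shows "runs prog_S (init_index m n) \<mu> (overwrite (Work 6) (\<lambda>_. S) {0} \<mu>) 3"
  using assms by (simp add: runs_def prog_S_def init_index_def override_on_insert S_def)

lemma runs_T:
  assumes "\<mu> Sizes 0 = real m" "\<And>i. i < m \<Longrightarrow> \<mu> (Work 3) i = b_col i"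
    "\<mu> (Work 5) 0 = total" "\<mu> (Work 6) 0 = S"
  shows "runs prog_T (init_index m n) \<mu> (overwrite (Work 7) T {..<m} \<mu>) (m * 2)"
proof -
  have "runs (for_cols (Seq
      (Arith (Cell (Work 7) grid_col) Add (Cell (Work 3) grid_col) (scalar 6))
      (Arith (Cell (Work 7) grid_col) Div (Cell (Work 7) grid_col) size_m)))
    (init_index m n) \<mu> (overwrite (Work 7) (\<lambda>i. (b_col i + S) / m) {..<m} \<mu>) (m * 2)"
    using m_pos
    by (intro runs_for_cols) (simp add: runs_def init_index_def override_on_insert assms)
  then show ?thesis
    using m_pos
    by (auto simp: runs_def prog_T_def init_index_def assms(3) override_on_def T_def fun_eq_iff)
qed

lemma runs_D:
  assumes "\<mu> Sizes 1 = real n" "\<mu> (Work 5) 0 = total"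
  shows "runs prog_D (init_index m n) \<mu> (overwrite (Work 8) (\<lambda>_. D) {0} \<mu>) 1"
  using assms n_pos by (simp add: runs_def prog_D_def override_on_insert D_def)

lemma runs_E:
  assumes "\<And>i. i < m \<Longrightarrow> \<mu> (Work 7) i = T i" "\<mu> (Work 5) 0 = total" "\<mu> (Work 8) 0 = D"
  shows "runs prog_E (init_index m n) \<mu> (overwrite (Work 9) E {..<m} \<mu>) 1"
proof -
  \<comment> \<open>Moves are free, hence the cost \<open>m * 0\<close>; only the final subtraction
    counts.\<close>
  have "runs (for_cols (Move (Cell (Work 9) grid_col) (Cell (Work 7) grid_col)))
    (init_index m n) \<mu> (overwrite (Work 9) T {..<m} \<mu>) (m * 0)"
    by (intro runs_for_cols) (simp add: runs_def init_index_def override_on_insert assms)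
  then show ?thesis
    using m_pos
    by (auto simp: runs_def prog_E_def init_index_def assms(2,3) override_on_def E_def fun_eq_iff)
qed

lemma runs_U:
  assumes "\<mu> Sizes 1 = real n" "\<And>k. k < n \<Longrightarrow> \<mu> (Work 4) k = b_row k"
    "\<mu> (Work 6) 0 = S" "\<mu> (Work 8) 0 = D"
  shows "runs prog_U (init_index m n) \<mu> (overwrite (Work 10) U {..<n} \<mu>) (n * 3)"
  unfolding prog_U_def
  by (rule runs_for_rows)
    (use n_pos assms(1) in \<open>simp add: runs_def init_index_def override_on_insert assms(2-) U_def\<close>)

lemma runs_mn:
  assumes "\<mu> Sizes 0 = real m" "\<mu> Sizes 1 = real n"
  shows "runs prog_mn (init_index m n) \<mu> (overwrite (Work 11) (\<lambda>_. real m + n) {0} \<mu>) 1"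
  using assms by (simp add: runs_def prog_mn_def override_on_insert)

lemma runs_u:
  assumes "\<And>k i. k < n \<Longrightarrow> i < m \<Longrightarrow> \<mu> (Work 2) (k * m + i) = b k i"
    "\<And>i. i < m \<Longrightarrow> \<mu> (Work 9) i = E i" "\<And>k. k < n \<Longrightarrow> \<mu> (Work 10) k = U k"
    "\<mu> (Work 11) 0 = real m + n"
  shows "runs prog_u (init_index m n) \<mu> (overwrite Output (flat m u) {0..<0 + n * m} \<mu>) (n * (m * 3))"
  unfolding prog_u_def
  by (rule runs_for_grid)
    (use m_pos in \<open>simp add: runs_def init_index_def override_on_insert assms u_def\<close>)

lemma runs_v:
  assumes "\<And>k i. k < n \<Longrightarrow> i < m \<Longrightarrow> \<mu> Input (m * n + (k * m + i)) = r\<^sub>2 k i"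
    "\<mu> Sizes 0 = real m" "\<And>k. k < n \<Longrightarrow> \<mu> (Work 10) k = U k"
  shows "runs prog_v (init_index m n) \<mu>
    (overwrite Output (\<lambda>x. flat m v (x - m * n)) {m * n..<m * n + n * m} \<mu>) (n * (m * 2))"
  unfolding prog_v_def
  by (rule runs_for_grid)
    (use m_pos in \<open>simp add: runs_def init_index_def override_on_insert assms v_def\<close>)

lemma runs_w:
  assumes "\<And>k i. k < n \<Longrightarrow> i < m \<Longrightarrow> \<mu> Input (2 * (m * n) + (k * m + i)) = r\<^sub>3 k i"
    "\<mu> Sizes 1 = real n" "\<And>i. i < m \<Longrightarrow> \<mu> (Work 7) i = T i"
  shows "runs prog_w (init_index m n) \<mu>
    (overwrite Output (\<lambda>x. flat m w (x - 2 * (m * n))) {2 * (m * n)..<2 * (m * n) + n * m} \<mu>)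
    (n * (m * 2))"
  unfolding prog_w_def
  by (rule runs_for_grid)
    (use n_pos assms(2) in \<open>simp add: runs_def init_index_def override_on_insert assms(1,3) w_def\<close>)

text \<open>At the corner index \<open>M3 m n\<close> this function has the value \<open>D\<close>,
  but \<open>vec (M3 m n) y\<close> ends just before it.\<close>

definition y :: "nat \<Rightarrow> real" where
  "y x = (if x < m * n then flat m u x
    else if x < 2 * (m * n) then flat m v (x - m * n)
    else flat m w (x - 2 * (m * n)))"

end

definition solver :: prog where
  "solver = Seq prog_P (Seq prog_Q (Seq prog_b (Seq prog_b_col (Seq prog_b_row (Seq prog_total
     (Seq prog_S (Seq prog_T (Seq prog_D (Seq prog_E (Seq prog_U (Seq prog_mn
     (Seq prog_u (Seq prog_v prog_w)))))))))))))"

lemma (in grid_system) runs_solver: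
  assumes "\<And>k i. k < n \<Longrightarrow> i < m \<Longrightarrow> \<mu> Input (k * m + i) = r\<^sub>1 k i"
    "\<And>k i. k < n \<Longrightarrow> i < m \<Longrightarrow> \<mu> Input (m * n + (k * m + i)) = r\<^sub>2 k i"
    "\<And>k i. k < n \<Longrightarrow> i < m \<Longrightarrow> \<mu> Input (2 * (m * n) + (k * m + i)) = r\<^sub>3 k i"
    "\<mu> Sizes 0 = real m" "\<mu> Sizes 1 = real n"
  obtains \<mu>' c where "runs solver (init_index m n) \<mu> \<mu>' c" "c \<le> 27 * (m * n)"
    "\<And>x. x < 3 * (m * n) \<Longrightarrow> \<mu>' Output x = y x"
proof -
  note pos = block_pos_less[of _ n _ m]
  \<comment> \<open>The simplified copy of \<open>assms(5)\<close> has the index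
    \<open>Suc 0\<close>, to which the simplifier rewrites \<open>1\<close>.\<close>
  note [simp] = assms assms(5)[simplified] m_pos n_pos pos

  \<comment> \<open>\<open>overwrite\<close> duplicates the memory: without names the terms would double with every phase.\<close>
  define \<mu>\<^sub>P where "\<mu>\<^sub>P = overwrite (Work 0) P {..<n} \<mu>"
  note [simp] = overwrite_apply[where a = "Work 0" and h = P
      and X = "{..<n}" and \<mu> = \<mu>, folded \<mu>\<^sub>P_def]
  have P: "runs prog_P (init_index m n) \<mu> \<mu>\<^sub>P (n * (m + 1))"
    unfolding \<mu>\<^sub>P_def by (rule runs_P) simp_all

  define \<mu>\<^sub>Q where "\<mu>\<^sub>Q = overwrite (Work 1) Q {..<m} \<mu>\<^sub>P"
  note [simp] = overwrite_apply[where a = "Work 1" and h = "Q"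
      and X = "{..<m}" and \<mu> = \<mu>\<^sub>P, folded \<mu>\<^sub>Q_def]
  have Q: "runs prog_Q (init_index m n) \<mu>\<^sub>P \<mu>\<^sub>Q (m * (n + 1))"
    unfolding \<mu>\<^sub>Q_def by (rule runs_Q) simp_all

  define \<mu>\<^sub>b where "\<mu>\<^sub>b = overwrite (Work 2) (flat m b) {0..<0 + n * m} \<mu>\<^sub>Q"
  note [simp] = overwrite_apply[where a = "Work 2" and h = "flat m b"
      and X = "{0..<0 + n * m}" and \<mu> = \<mu>\<^sub>Q, folded \<mu>\<^sub>b_def]
  have b: "runs prog_b (init_index m n) \<mu>\<^sub>Q \<mu>\<^sub>b (n * (m * 2))"
    unfolding \<mu>\<^sub>b_def by (rule runs_b) simp_all

  define \<mu>_b_col where "\<mu>_b_col = overwrite (Work 3) b_col {..<m} \<mu>\<^sub>b"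
  note [simp] = overwrite_apply[where a = "Work 3" and h = "b_col"
      and X = "{..<m}" and \<mu> = \<mu>\<^sub>b, folded \<mu>_b_col_def]
  have b_col: "runs prog_b_col (init_index m n) \<mu>\<^sub>b \<mu>_b_col (m * n)"
    unfolding \<mu>_b_col_def by (rule runs_b_col) simp_all

  define \<mu>_b_row where "\<mu>_b_row = overwrite (Work 4) b_row {..<n} \<mu>_b_col"
  note [simp] = overwrite_apply[where a = "Work 4" and h = "b_row"
      and X = "{..<n}" and \<mu> = \<mu>_b_col, folded \<mu>_b_row_def]
  have b_row: "runs prog_b_row (init_index m n) \<mu>_b_col \<mu>_b_row (n * m)"
    unfolding \<mu>_b_row_def by (rule runs_b_row) simp_all

  define \<mu>_total where "\<mu>_total = overwrite (Work 5) (\<lambda>_. total) {0} \<mu>_b_row"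
  note [simp] = overwrite_apply[where a = "Work 5" and h = "\<lambda>_. total"
      and X = "{0}" and \<mu> = \<mu>_b_row, folded \<mu>_total_def]
  have total: "runs prog_total (init_index m n) \<mu>_b_row \<mu>_total m"
    unfolding \<mu>_total_def by (rule runs_total) simp_all

  define \<mu>\<^sub>S where "\<mu>\<^sub>S = overwrite (Work 6) (\<lambda>_. S) {0} \<mu>_total"
  note [simp] = overwrite_apply[where a = "Work 6" and h = "\<lambda>_. S"
      and X = "{0}" and \<mu> = \<mu>_total, folded \<mu>\<^sub>S_def]
  have S: "runs prog_S (init_index m n) \<mu>_total \<mu>\<^sub>S 3"
    unfolding \<mu>\<^sub>S_def by (rule runs_S) simp_all

  define \<mu>\<^sub>T where "\<mu>\<^sub>T = overwrite (Work 7) T {..<m} \<mu>\<^sub>S"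
  note [simp] = overwrite_apply[where a = "Work 7" and h = "T"
      and X = "{..<m}" and \<mu> = \<mu>\<^sub>S, folded \<mu>\<^sub>T_def]
  have T: "runs prog_T (init_index m n) \<mu>\<^sub>S \<mu>\<^sub>T (m * 2)"
    unfolding \<mu>\<^sub>T_def by (rule runs_T) simp_all

  define \<mu>\<^sub>D where "\<mu>\<^sub>D = overwrite (Work 8) (\<lambda>_. D) {0} \<mu>\<^sub>T"
  note [simp] = overwrite_apply[where a = "Work 8" and h = "\<lambda>_. D"
      and X = "{0}" and \<mu> = \<mu>\<^sub>T, folded \<mu>\<^sub>D_def]
  have D: "runs prog_D (init_index m n) \<mu>\<^sub>T \<mu>\<^sub>D 1"
    unfolding \<mu>\<^sub>D_def by (rule runs_D) simp_all

  define \<mu>\<^sub>E where "\<mu>\<^sub>E = overwrite (Work 9) E {..<m} \<mu>\<^sub>D"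
  note [simp] = overwrite_apply[where a = "Work 9" and h = "E"
      and X = "{..<m}" and \<mu> = \<mu>\<^sub>D, folded \<mu>\<^sub>E_def]
  have E: "runs prog_E (init_index m n) \<mu>\<^sub>D \<mu>\<^sub>E 1"
    unfolding \<mu>\<^sub>E_def by (rule runs_E) simp_all

  define \<mu>\<^sub>U where "\<mu>\<^sub>U = overwrite (Work 10) U {..<n} \<mu>\<^sub>E"
  note [simp] = overwrite_apply[where a = "Work 10" and h = "U"
      and X = "{..<n}" and \<mu> = \<mu>\<^sub>E, folded \<mu>\<^sub>U_def]
  have U: "runs prog_U (init_index m n) \<mu>\<^sub>E \<mu>\<^sub>U (n * 3)"
    unfolding \<mu>\<^sub>U_def by (rule runs_U) simp_all

  define \<mu>_mn where "\<mu>_mn = overwrite (Work 11) (\<lambda>_. real m + n) {0} \<mu>\<^sub>U"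
  note [simp] = overwrite_apply[where a = "Work 11" and h = "\<lambda>_. real m + n"
      and X = "{0}" and \<mu> = \<mu>\<^sub>U, folded \<mu>_mn_def]
  have mn: "runs prog_mn (init_index m n) \<mu>\<^sub>U \<mu>_mn 1"
    unfolding \<mu>_mn_def by (rule runs_mn) simp_all

  define \<mu>\<^sub>u where "\<mu>\<^sub>u = overwrite Output (flat m u) {0..<0 + n * m} \<mu>_mn"
  note [simp] = overwrite_apply[where a = Output and h = "flat m u"
      and X = "{0..<0 + n * m}" and \<mu> = \<mu>_mn, folded \<mu>\<^sub>u_def]
  have u: "runs prog_u (init_index m n) \<mu>_mn \<mu>\<^sub>u (n * (m * 3))"
    unfolding \<mu>\<^sub>u_def by (rule runs_u) simp_all

  define \<mu>\<^sub>v where "\<mu>\<^sub>v = overwrite Output (\<lambda>x. flat m v (x - m * n)) {m * n..<m * n + n * m} \<mu>\<^sub>u"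
  note [simp] = overwrite_apply[where a = Output and h = "\<lambda>x. flat m v (x - m * n)"
      and X = "{m * n..<m * n + n * m}" and \<mu> = \<mu>\<^sub>u, folded \<mu>\<^sub>v_def]
  have v: "runs prog_v (init_index m n) \<mu>\<^sub>u \<mu>\<^sub>v (n * (m * 2))"
    unfolding \<mu>\<^sub>v_def by (rule runs_v) simp_all

  define \<mu>\<^sub>w where "\<mu>\<^sub>w = overwrite Output (\<lambda>x. flat m w (x - 2 * (m * n)))
      {2 * (m * n)..<2 * (m * n) + n * m} \<mu>\<^sub>v"
  note [simp] = overwrite_apply[where a = Output and h = "\<lambda>x. flat m w (x - 2 * (m * n))"
      and X = "{2 * (m * n)..<2 * (m * n) + n * m}" and \<mu> = \<mu>\<^sub>v, folded \<mu>\<^sub>w_def]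
  have w: "runs prog_w (init_index m n) \<mu>\<^sub>v \<mu>\<^sub>w (n * (m * 2))"
    unfolding \<mu>\<^sub>w_def by (rule runs_w) simp_all

  \<comment> \<open>The sum is \<open>13 * m * n + 4 * m + 4 * n + 6\<close>. Each of
    \<open>m\<close>, \<open>n\<close> and \<open>1\<close> is at most \<open>m * n\<close>, and
    \<open>13 + 4 + 4 + 6 = 27\<close>.\<close>
  have cost: "(n * (m + 1) + (m * (n + 1) + (n * (m * 2) + (m * n + (n * m + (m + (3 + (m * 2 +
      (1 + (1 + (n * 3 + (1 + (n * (m * 3) + (n * (m * 2) + (n * (m * 2)))))))))))))))) \<le> 27 * (m * n)"
    (is "?c \<le> _")
  proof -
    have "n \<le> m * n" "m \<le> m * n" "1 \<le> m * n"
      using m_pos n_pos by (simp_all add: Suc_leI)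
    then show ?thesis
      unfolding mult.assoc[of n m, symmetric] mult.commute[of n m] distrib_left by linarith
  qed
  show thesis
  proof (rule that[OF _ cost])
    show "runs solver (init_index m n) \<mu> \<mu>\<^sub>w ?c"
      unfolding solver_def by (intro runs_Seq) (fact P Q b b_col b_row total S T D E U mn u v w)+
  qed (auto simp: y_def mult.commute[of n m])
qed

section \<open>Entries of the matrix\<close>

lemma index_kronecker:
  assumes "i < dim_row A * dim_row B" "j < dim_col A * dim_col B"
  shows "(A \<otimes>\<^sub>K B) $$ (i, j) =
    A $$ (i div dim_row B, j div dim_col B) * B $$ (i mod dim_row B, j mod dim_col B)"
  using assms by (simp add: kronecker_def)

text \<open>The last block \<open>C\<close> consists of the first \<open>nr'\<close> rows of
  \<open>B\<close>, so the entries are those of a block diagonal of \<open>k + 1\<close> copies of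
  \<open>B\<close>, restricted to fewer rows. This is the shape of \<open>A4\<close>.\<close>

lemma index_diag_block_mat_replicate:
  assumes B: "B \<in> carrier_mat nr nc" and C: "C \<in> carrier_mat nr' nc" and "nr' \<le> nr"
    and eq: "\<And>i j. i < nr' \<Longrightarrow> j < nc \<Longrightarrow> C $$ (i, j) = B $$ (i, j)"
    and "i < k * nr + nr'" "j < Suc k * nc"
  shows "diag_block_mat (replicate k B @ [C]) $$ (i, j) =
    (if i div nr = j div nc then B $$ (i mod nr, j mod nc) else 0)"
  using assms(5,6)
proof (induction k arbitrary: i j)
  case 0
  then show ?case
    using eq \<open>nr' \<le> nr\<close> by (simp del: diag_block_mat.simps)
next
  case (Suc k)
  have pos: "0 < nc" "0 < nr"
    using Suc.prems \<open>nr' \<le> nr\<close> by (auto intro: Nat.gr0I)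
  let ?D = "diag_block_mat (replicate k B @ [C])"
  have dim: "dim_row ?D = k * nr + nr'" "dim_col ?D = Suc k * nc"
    using B C by (simp_all add: dim_diag_block_mat sum_list_replicate)
  have div: "i div nr = Suc ((i - nr) div nr)" "i mod nr = (i - nr) mod nr" if "\<not> i < nr"
    using that pos by (simp_all add: le_div_geq le_mod_geq)
  have div': "j div nc = Suc ((j - nc) div nc)" "j mod nc = (j - nc) mod nc" if "\<not> j < nc"
    using that pos by (simp_all add: le_div_geq le_mod_geq)
  have "diag_block_mat (replicate (Suc k) B @ [C]) $$ (i, j) =
    (if i < nr then if j < nc then B $$ (i, j) else 0
     else if j < nc then 0 else ?D $$ (i - nr, j - nc))"
    using Suc.prems B dim by (simp add: Let_def)
  also have "\<dots> = (if i div nr = j div nc then B $$ (i mod nr, j mod nc) else 0)"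
    using Suc.prems Suc.IH[of "i - nr" "j - nc"] by (auto simp: div div')
  finally show ?case .
qed

lemma dim_ones_row [simp]: "dim_row (ones_row p) = 1" "dim_col (ones_row p) = p"
  by (simp_all add: ones_row_def)

lemma index_ones_row [simp]: "j < p \<Longrightarrow> ones_row p $$ (0, j) = 1"
  by (simp add: ones_row_def)

lemma index_identity_stack:
  assumes "i < m" "j < n * m"
  shows "(ones_row n \<otimes>\<^sub>K 1\<^sub>m m) $$ (i, j) = (if i = j mod m then 1 else 0)"
  using assms by (subst index_kronecker) (simp_all add: less_mult_imp_div_less)

lemma index_I_bar_stack:
  assumes "i < m - 1" "j < n * m"
  shows "(ones_row n \<otimes>\<^sub>K I_bar m) $$ (i, j) = (if i = j mod m then 1 else 0)"
  using assms
  by (subst index_kronecker) (simp_all add: I_bar_def less_mult_imp_div_less)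

section \<open>Entries of the four blocks and of the whole matrix\<close>

lemma div_eq_and_mod_eq_iff:
  "r < m \<Longrightarrow> x div m = k \<and> x mod m = r \<longleftrightarrow> x = k * m + r" for x :: nat
  by auto

text \<open>Left columns are read as \<open>(k * m + i) * m + j\<close>, with a one in row
  \<open>k * m + i\<close> of \<open>A1\<close> and in row \<open>k * m + j\<close> of
  \<open>A3\<close>. Right columns are read as \<open>(l * n + s) * m + i\<close>, with the nonzero
  entry of \<open>A2\<close> in row \<open>s * m + i\<close> and that of \<open>A4\<close> in row
  \<open>l * m + i\<close>, if this row exists.\<close>

lemma index_A1:
  assumes "r < m * n" "c < m\<^sup>2 * n"
  shows "A1 m n $$ (r, c) = (if r = c div m then 1 else 0)"
proof -
  have "0 < m" using assms by (auto intro: Nat.gr0I)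
  moreover have "c div m < m * n"
    using assms by (intro less_mult_imp_div_less) (simp add: power2_eq_square ac_simps)
  ultimately show ?thesis
    using assms unfolding A1_def
    by (subst index_kronecker) (simp_all add: power2_eq_square ac_simps)
qed

lemma index_A2:
  assumes "r < m * n" "c < m * n\<^sup>2"
  shows "A2 m n $$ (r, c) = - (if r = c mod (m * n) then 1 else 0)"
proof -
  have "0 < m * n" using assms by (auto intro: Nat.gr0I)
  moreover have "c div (m * n) < n"
    using assms by (intro less_mult_imp_div_less) (simp add: power2_eq_square ac_simps)
  ultimately show ?thesis
    using assms unfolding A2_def
    by (subst index_kronecker) (simp_all add: power2_eq_square ac_simps)
qed

lemma index_A3:
  assumes "r < m * n" "c < m\<^sup>2 * n"
  shows "A3 m n $$ (r, c) = (if r = c div (m * m) * m + c mod m then 1 else 0)"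
proof -
  have m: "0 < m" using assms by (auto intro: Nat.gr0I)
  have "c div (m * m) < n" "r div m < n"
    using assms
    by (auto intro!: less_mult_imp_div_less simp: power2_eq_square ac_simps)
  then have "A3 m n $$ (r, c) = (if r div m = c div (m * m) \<and> r mod m = c mod m then 1 else 0)"
    using assms m unfolding A3_def
    by (subst index_kronecker)
      (simp_all add: power2_eq_square ac_simps index_identity_stack
        mod_mod_cancel[of m "m * m"])
  then show ?thesis
    using m by (simp add: div_eq_and_mod_eq_iff)
qed

lemma index_A4:
  assumes "0 < m" "0 < n" "r < m * n - 1" "c < m * n\<^sup>2"
  shows "A4 m n $$ (r, c) = (if r = c div (n * m) * m + c mod m then 1 else 0)"
proof -
  have "A4 m n $$ (r, c) = (if r div m = c div (n * m)
      then (ones_row n \<otimes>\<^sub>K 1\<^sub>m m) $$ (r mod m, c mod (n * m)) else 0)"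
    unfolding A4_def
  proof (rule index_diag_block_mat_replicate)
    show "ones_row n \<otimes>\<^sub>K 1\<^sub>m m \<in> carrier_mat m (n * m)"
      "ones_row n \<otimes>\<^sub>K I_bar m \<in> carrier_mat (m - 1) (n * m)"
      by (auto intro!: carrier_matI simp: I_bar_def)
    show "r < (n - 1) * m + (m - 1)" "c < Suc (n - 1) * (n * m)"
      using assms by (cases n; simp add: power2_eq_square algebra_simps)+
  qed (simp_all add: index_identity_stack index_I_bar_stack)
  then show ?thesis
    using assms
    by (simp add: index_identity_stack mod_mod_cancel flip: div_eq_and_mod_eq_iff)
qed

text \<open>The deleted row of \<open>A4\<close> needs no case distinction: its index would be
  \<open>M3 m n\<close>, which \<open>r\<close> never reaches.\<close>

lemma index_A_mat:
  assumes "0 < m" "0 < n" "r < M3 m n"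
  shows "c < m\<^sup>2 * n \<Longrightarrow> A_mat m n $$ (r, c) =
      (if r = c div m then 1 else 0) + (if r = m * n + (c div (m * m) * m + c mod m) then 1 else 0)"
    and "c < m * n\<^sup>2 \<Longrightarrow> A_mat m n $$ (r, m\<^sup>2 * n + c) =
      (if r = 2 * (m * n) + (c div (n * m) * m + c mod m) then 1 else 0) -
      (if r = c mod (m * n) then 1 else 0)"
proof -
  let ?M = "m * n"
  have A1: "A1 m n \<in> carrier_mat ?M (m\<^sup>2 * n)"
    by (rule carrier_matI) (simp_all add: A1_def power2_eq_square)
  have A3: "A3 m n \<in> carrier_mat ?M (m\<^sup>2 * n)"
    by (rule carrier_matI) (simp_all add: A3_def power2_eq_square)
  have "n * m - m + (m - 1) = ?M - 1"
    using assms by (cases n) (simp_all add: algebra_simps)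
  then have A4: "A4 m n \<in> carrier_mat (?M - 1) (m * n\<^sup>2)"
    using assms by (intro carrier_matI)
      (simp_all add: A4_def dim_diag_block_mat I_bar_def sum_list_replicate
        power2_eq_square algebra_simps)
  have r: "r < ?M + (?M + (?M - 1))"
    using assms by (simp add: M3_def)
  show "A_mat m n $$ (r, c) =
      (if r = c div m then 1 else 0) + (if r = m * n + (c div (m * m) * m + c mod m) then 1 else 0)"
    if c: "c < m\<^sup>2 * n"
  proof -
    have "c div m < ?M"
      using c by (intro less_mult_imp_div_less) (simp add: power2_eq_square ac_simps)
    have "c div (m * m) < n"
      using c by (intro less_mult_imp_div_less) (simp add: power2_eq_square ac_simps)
    then have "c div (m * m) * m + c mod m < ?M"
      using block_pos_less[of "c div (m * m)" n "c mod m" m] assms by (simp add: ac_simps)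
    then show ?thesis
      using r c A1 A3 A4 \<open>c div m < ?M\<close>
      by (auto simp: A_mat_def append_rows_def index_A1 index_A3)
  qed
  show "A_mat m n $$ (r, m\<^sup>2 * n + c) =
      (if r = 2 * (m * n) + (c div (n * m) * m + c mod m) then 1 else 0) -
      (if r = c mod (m * n) then 1 else 0)"
    if c: "c < m * n\<^sup>2"
  proof -
    have "c mod ?M < ?M"
      using assms by simp
    then show ?thesis
      using r c A1 A3 A4 assms
      by (auto simp: A_mat_def append_rows_def index_A2 index_A4)
  qed
qed

section \<open>Sums over grids and decomposition of indices\<close>

lemma sum_blocks: "(\<Sum>c<a * b. f c) = (\<Sum>i<a. \<Sum>j<b. f (i * b + j))" for f :: "nat \<Rightarrow> 'a::comm_monoid_add"
proof -
  have "sum f {i * b..<i * b + b} = (\<Sum>j<b. f (i * b + j))" for i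
    using sum.shift_bounds_nat_ivl[of f 0 "i * b" b] by (simp add: atLeast0LessThan ac_simps)
  then show ?thesis
    by (simp flip: sum.nat_group)
qed

lemma block_pos_eq_iff:
  fixes a b c d p :: nat
  assumes "c < p" "d < p"
  shows "a * p + c = b * p + d \<longleftrightarrow> a = b \<and> c = d"
proof -
  have "(a * p + c) div p = a" "(b * p + d) div p = b"
    using assms by simp_all
  then show ?thesis by auto
qed

text \<open>Block number, grid row and grid column are the digits of a row index, hence unique. This
  evaluates each of the sums in \<open>A_mat_mult_vec\<close>, with \<open>b\<close> as the
  block.\<close>

lemma sum_grid_delta:
  fixes f :: "nat \<Rightarrow> nat \<Rightarrow> real"
  assumes "k\<^sub>0 < n" "i\<^sub>0 < m"
  shows "(\<Sum>k<n. \<Sum>i<m. if a * (m * n) + (k\<^sub>0 * m + i\<^sub>0) = b * (m * n) + (k * m + i) then f k i else 0) =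
    (if a = b then f k\<^sub>0 i\<^sub>0 else 0)"
proof -
  have "a * (m * n) + (k\<^sub>0 * m + i\<^sub>0) = b * (m * n) + (k * m + i) \<longleftrightarrow> a = b \<and> k\<^sub>0 = k \<and> i\<^sub>0 = i"
    if "k < n" "i < m" for k i
    unfolding mult.commute[of m n]
    using assms that by (subst block_pos_eq_iff) (auto intro: block_pos_less simp: block_pos_eq_iff)
  then have "(\<Sum>k<n. \<Sum>i<m. if a * (m * n) + (k\<^sub>0 * m + i\<^sub>0) = b * (m * n) + (k * m + i) then f k i else 0) =
    (\<Sum>k<n. \<Sum>i<m. if i\<^sub>0 = i then if k\<^sub>0 = k then if a = b then f k i else 0 else 0 else 0)"
    by (intro sum.cong refl) auto
  also have "\<dots> = (if a = b then f k\<^sub>0 i\<^sub>0 else 0)"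
    using assms by (simp add: sum.delta)
  finally show ?thesis .
qed

text \<open>The corner comes last in row-major order, and \<open>M3 m n\<close> is one less than the
  size of three full grids.\<close>

lemma third_block_pos_less_iff:
  assumes "k < n" "i < m"
  shows "2 * (m * n) + (k * m + i) < M3 m n \<longleftrightarrow> \<not> (k = n - 1 \<and> i = m - 1)"
proof -
  have "k * m + i < m * n"
    using block_pos_less[OF assms] by (simp add: mult.commute)
  moreover have "(n - 1) * m + (m - 1) = m * n - 1"
    using assms by (cases n) (simp_all add: algebra_simps)
  moreover have "k * m + i = (n - 1) * m + (m - 1) \<longleftrightarrow> k = n - 1 \<and> i = m - 1"
    using assms by (intro block_pos_eq_iff) simp_all
  ultimately show ?thesis
    by (auto simp: M3_def)
qed

text \<open>Right columns use this as stated, left columns with \<open>n\<close> replaced by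
  \<open>m\<close>.\<close>

lemma nested_index:
  fixes l s i m n :: nat
  assumes "s < n" "i < m"
  shows "((l * n + s) * m + i) div m = l * n + s" "((l * n + s) * m + i) mod m = i"
    "((l * n + s) * m + i) div (n * m) = l" "((l * n + s) * m + i) mod (m * n) = s * m + i"
  using assms
  by (simp_all add: mult.commute[of n m] div_mult2_eq mod_mult2_eq mult.commute[of s m])

section \<open>Multiplication by the matrix and by its transpose\<close>

lemma sum_lessThan_add:
  "(\<Sum>c<a + b. f c) = (\<Sum>c<a. f c) + (\<Sum>c<b. f (a + c))" for f :: "nat \<Rightarrow> 'a::comm_monoid_add"
  by (induction b) (simp_all add: add.assoc)

text \<open>Keeping the conditions on \<open>r\<close> inside grid sums lets one formula cover all
  three blocks of rows.\<close>

lemma A_mat_mult_vec: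
  assumes mn: "0 < m" "0 < n" and r: "r < M3 m n" and dim: "dim_vec x = m\<^sup>2 * n + m * n\<^sup>2"
    and X: "\<And>k i j. k < n \<Longrightarrow> i < m \<Longrightarrow> j < m \<Longrightarrow> x $ ((k * m + i) * m + j) = X k i j"
    and Z: "\<And>l s i. l < n \<Longrightarrow> s < n \<Longrightarrow> i < m \<Longrightarrow> x $ (m\<^sup>2 * n + ((l * n + s) * m + i)) = Z l s i"
  shows "(A_mat m n *\<^sub>v x) $ r =
    (\<Sum>k<n. \<Sum>i<m. if r = k * m + i then \<Sum>j<m. X k i j else 0) +
    (\<Sum>k<n. \<Sum>j<m. if r = m * n + (k * m + j) then \<Sum>i<m. X k i j else 0) +
    ((\<Sum>l<n. \<Sum>i<m. if r = 2 * (m * n) + (l * m + i) then \<Sum>s<n. Z l s i else 0) -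
     (\<Sum>s<n. \<Sum>i<m. if r = s * m + i then \<Sum>l<n. Z l s i else 0))"
proof -
  let ?A = "A_mat m n"
  have brackets: "((if P then 1 else 0) + (if Q then 1 else 0)) * z =
      (if P then z else 0) + (if Q then z else 0)"
    "((if P then 1 else 0) - (if Q then 1 else 0)) * z = (if P then z else 0) - (if Q then z else 0)"
    for P Q and z :: real
    by simp_all
  have sum_if: "(\<Sum>j<p. if c then f j else 0) = (if c then \<Sum>j<p. f j else 0)"
    for c and f :: "nat \<Rightarrow> real" and p
    by simp
  have "(\<Sum>c<m\<^sup>2 * n. ?A $$ (r, c) * x $ c) = (\<Sum>c<n * m * m.
      ((if r = c div m then 1 else 0) + (if r = m * n + (c div (m * m) * m + c mod m) then 1 else 0))
        * x $ c)"
    using index_A_mat(1)[OF mn r] by (intro sum.cong) (simp_all add: power2_eq_square ac_simps)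
  also have "\<dots> = (\<Sum>k<n. \<Sum>i<m. \<Sum>j<m.
      ((if r = k * m + i then 1 else 0) + (if r = m * n + (k * m + j) then 1 else 0)) * X k i j)"
    unfolding sum_blocks by (intro sum.cong refl) (simp add: X nested_index)
  also have "\<dots> = (\<Sum>k<n. \<Sum>i<m. \<Sum>j<m. if r = k * m + i then X k i j else 0) +
      (\<Sum>k<n. \<Sum>i<m. \<Sum>j<m. if r = m * n + (k * m + j) then X k i j else 0)"
    by (simp only: brackets sum.distrib)
  \<comment> \<open>The condition does not involve \<open>i\<close>; with the sum over
    \<open>i\<close> innermost, \<open>sum_if\<close> can pull the condition out.\<close>
  also have "(\<Sum>k<n. \<Sum>i<m. \<Sum>j<m. if r = m * n + (k * m + j) then X k i j else 0) =
      (\<Sum>k<n. \<Sum>j<m. \<Sum>i<m. if r = m * n + (k * m + j) then X k i j else 0)"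
    by (intro sum.cong refl sum.swap)
  finally have upper: "(\<Sum>c<m\<^sup>2 * n. ?A $$ (r, c) * x $ c) =
      (\<Sum>k<n. \<Sum>i<m. if r = k * m + i then \<Sum>j<m. X k i j else 0) +
      (\<Sum>k<n. \<Sum>j<m. if r = m * n + (k * m + j) then \<Sum>i<m. X k i j else 0)"
    by (simp only: sum_if)
  have "(\<Sum>c<m * n\<^sup>2. ?A $$ (r, m\<^sup>2 * n + c) * x $ (m\<^sup>2 * n + c)) = (\<Sum>c<n * n * m.
      ((if r = 2 * (m * n) + (c div (n * m) * m + c mod m) then 1 else 0) -
       (if r = c mod (m * n) then 1 else 0)) * x $ (m\<^sup>2 * n + c))"
    using index_A_mat(2)[OF mn r] by (intro sum.cong) (simp_all add: power2_eq_square ac_simps)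
  also have "\<dots> = (\<Sum>l<n. \<Sum>s<n. \<Sum>i<m.
      ((if r = 2 * (m * n) + (l * m + i) then 1 else 0) - (if r = s * m + i then 1 else 0)) * Z l s i)"
    unfolding sum_blocks by (intro sum.cong refl)
      (simp add: Z nested_index)
  also have "\<dots> = (\<Sum>l<n. \<Sum>s<n. \<Sum>i<m. if r = 2 * (m * n) + (l * m + i) then Z l s i else 0) -
      (\<Sum>l<n. \<Sum>s<n. \<Sum>i<m. if r = s * m + i then Z l s i else 0)"
    by (simp only: brackets sum_subtractf)
  also have "(\<Sum>l<n. \<Sum>s<n. \<Sum>i<m. if r = 2 * (m * n) + (l * m + i) then Z l s i else 0) =
      (\<Sum>l<n. \<Sum>i<m. \<Sum>s<n. if r = 2 * (m * n) + (l * m + i) then Z l s i else 0)"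
    by (intro sum.cong refl sum.swap)
  also have "(\<Sum>l<n. \<Sum>s<n. \<Sum>i<m. if r = s * m + i then Z l s i else 0) =
      (\<Sum>s<n. \<Sum>i<m. \<Sum>l<n. if r = s * m + i then Z l s i else 0)"
    by (subst sum.swap) (intro sum.cong refl sum.swap)
  finally have lower: "(\<Sum>c<m * n\<^sup>2. ?A $$ (r, m\<^sup>2 * n + c) * x $ (m\<^sup>2 * n + c)) =
      (\<Sum>l<n. \<Sum>i<m. if r = 2 * (m * n) + (l * m + i) then \<Sum>s<n. Z l s i else 0) -
      (\<Sum>s<n. \<Sum>i<m. if r = s * m + i then \<Sum>l<n. Z l s i else 0)"
    by (simp only: sum_if)
  have "(?A *\<^sub>v x) $ r = (\<Sum>c<m\<^sup>2 * n + m * n\<^sup>2. ?A $$ (r, c) * x $ c)"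
    using A_mat_carrier[OF mn] r dim by (auto simp: scalar_prod_def atLeast0LessThan)
  then show ?thesis
    by (simp only: sum_lessThan_add upper lower)
qed

text \<open>A column has at most two nonzero entries, so at most two entries of \<open>y\<close>
  contribute. The deleted row acts like a \<open>0\<close> at the corner.\<close>

lemma A_mat_transpose_mult_vec:
  fixes y :: "nat \<Rightarrow> real"
  assumes mn: "0 < m" "0 < n"
  shows "k < n \<Longrightarrow> i < m \<Longrightarrow> j < m \<Longrightarrow>
      (transpose_mat (A_mat m n) *\<^sub>v vec (M3 m n) y) $ ((k * m + i) * m + j) =
      y (k * m + i) + y (m * n + (k * m + j))"
    and "l < n \<Longrightarrow> s < n \<Longrightarrow> i < m \<Longrightarrow>
      (transpose_mat (A_mat m n) *\<^sub>v vec (M3 m n) y) $ (m\<^sup>2 * n + ((l * n + s) * m + i)) =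
      (if l = n - 1 \<and> i = m - 1 then 0 else y (2 * (m * n) + (l * m + i))) - y (s * m + i)"
proof -
  let ?A = "A_mat m n"
  have brackets: "((if P then 1 else 0) + (if Q then 1 else 0)) * z =
      (if P then z else 0) + (if Q then z else 0)"
    "((if P then 1 else 0) - (if Q then 1 else 0)) * z = (if P then z else 0) - (if Q then z else 0)"
    for P Q and z :: real
    by simp_all
  have index: "(transpose_mat ?A *\<^sub>v vec (M3 m n) y) $ c = (\<Sum>r<M3 m n. ?A $$ (r, c) * y r)"
    if "c < m\<^sup>2 * n + m * n\<^sup>2" for c
    using A_mat_carrier[OF mn] that by (auto simp: scalar_prod_def atLeast0LessThan)
  have less: "k * m + i < m * n" if "k < n" "i < m" for k i
    using block_pos_less[OF that] by (simp add: mult.commute)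
  have M3: "2 * (m * n) \<le> M3 m n"
    using mn by (simp add: M3_def Suc_le_eq)
  show "(transpose_mat ?A *\<^sub>v vec (M3 m n) y) $ ((k * m + i) * m + j) =
      y (k * m + i) + y (m * n + (k * m + j))" if "k < n" "i < m" "j < m"
  proof -
    let ?c = "(k * m + i) * m + j"
    have c: "?c < m\<^sup>2 * n"
      using block_pos_less[OF less[OF that(1,2)] that(3)] by (simp add: power2_eq_square ac_simps)
    have div: "?c div m = k * m + i" "?c div (m * m) = k" "?c mod m = j"
      using that by (simp_all only: nested_index)
    have "(transpose_mat ?A *\<^sub>v vec (M3 m n) y) $ ?c = (\<Sum>r<M3 m n. ?A $$ (r, ?c) * y r)"
      using c by (intro index) simp
    also have "\<dots> = (\<Sum>r<M3 m n.
        (if r = k * m + i then y r else 0) + (if r = m * n + (k * m + j) then y r else 0))"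
      by (intro sum.cong refl)
        (simp only: lessThan_iff index_A_mat(1)[OF mn _ c] div brackets)
    also have "\<dots> = y (k * m + i) + y (m * n + (k * m + j))"
      using less[of k i] less[of k j] that M3 by (simp add: sum.distrib)
    finally show ?thesis .
  qed
  show "(transpose_mat ?A *\<^sub>v vec (M3 m n) y) $ (m\<^sup>2 * n + ((l * n + s) * m + i)) =
      (if l = n - 1 \<and> i = m - 1 then 0 else y (2 * (m * n) + (l * m + i))) - y (s * m + i)"
    if "l < n" "s < n" "i < m"
  proof -
    let ?c = "(l * n + s) * m + i"
    have c: "?c < m * n\<^sup>2"
      using block_pos_less[OF block_pos_less[OF that(1,2)] that(3)]
      by (simp add: power2_eq_square ac_simps)
    have div: "?c div (n * m) = l" "?c mod (m * n) = s * m + i" "?c mod m = i"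
      using that by (simp_all only: nested_index)
    have "(transpose_mat ?A *\<^sub>v vec (M3 m n) y) $ (m\<^sup>2 * n + ?c) =
        (\<Sum>r<M3 m n. ?A $$ (r, m\<^sup>2 * n + ?c) * y r)"
      using c by (intro index) simp
    also have "\<dots> = (\<Sum>r<M3 m n.
        (if r = 2 * (m * n) + (l * m + i) then y r else 0) - (if r = s * m + i then y r else 0))"
      by (intro sum.cong refl)
        (simp only: lessThan_iff index_A_mat(2)[OF mn _ c] div brackets)
    \<comment> \<open>The remaining bound test fails exactly at the corner, where the row is
      missing.\<close>
    also have "\<dots> = (if 2 * (m * n) + (l * m + i) < M3 m n then y (2 * (m * n) + (l * m + i)) else 0)
        - y (s * m + i)"
      using less[of s i] that M3 by (simp add: sum_subtractf)
    finally show ?thesis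
      using that by (simp add: third_block_pos_less_iff)
  qed
qed

text \<open>Applying the transpose first and then the matrix itself produces the left sides of
  \<open>equation_1\<close>, \<open>equation_2\<close> and \<open>equation_3\<close>, selected by
  the block number \<open>a\<close>.\<close>

lemma (in grid_system) normal_equations:
  assumes "a < 3" "k < n" "i < m" "a * (m * n) + (k * m + i) < M3 m n"
  shows "((A_mat m n * transpose_mat (A_mat m n)) *\<^sub>v vec (M3 m n) y) $ (a * (m * n) + (k * m + i)) =
    (if a = 0 then r\<^sub>1 k i else if a = 1 then r\<^sub>2 k i else r\<^sub>3 k i)"
proof -
  let ?A = "A_mat m n" and ?r = "a * (m * n) + (k * m + i)"
  have A: "?A \<in> carrier_mat (M3 m n) (m\<^sup>2 * n + m * n\<^sup>2)"
    using m_pos n_pos by (rule A_mat_carrier)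
  have less: "k * m + i < m * n" if "k < n" "i < m" for k i
    using block_pos_less[OF that] by (simp add: mult.commute)
  have y: "y (k * m + i) = u k i" "y (m * n + (k * m + i)) = v k i"
    "y (2 * (m * n) + (k * m + i)) = w k i" if "k < n" "i < m" for k i
    using less[OF that] that by (auto simp: y_def)
  have "((?A * transpose_mat ?A) *\<^sub>v vec (M3 m n) y) $ ?r =
      (?A *\<^sub>v (transpose_mat ?A *\<^sub>v vec (M3 m n) y)) $ ?r"
    using A by (subst assoc_mult_mat_vec) auto
  \<comment> \<open>The factors \<open>0\<close>, \<open>1\<close> and \<open>2\<close> of
    \<open>m * n\<close> bring every sum into the form of \<open>sum_grid_delta\<close>.\<close>
  also have "\<dots> =
    (\<Sum>k'<n. \<Sum>i'<m. if ?r = 0 * (m * n) + (k' * m + i')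
      then \<Sum>j<m. u k' i' + v k' j else 0) +
    (\<Sum>k'<n. \<Sum>j<m. if ?r = 1 * (m * n) + (k' * m + j)
      then \<Sum>i'<m. u k' i' + v k' j else 0) +
    ((\<Sum>l<n. \<Sum>i'<m. if ?r = 2 * (m * n) + (l * m + i')
      then \<Sum>s<n. (if l = n - 1 \<and> i' = m - 1 then 0 else w l i') - u s i' else 0) -
     (\<Sum>s<n. \<Sum>i'<m. if ?r = 0 * (m * n) + (s * m + i')
      then \<Sum>l<n. (if l = n - 1 \<and> i' = m - 1 then 0 else w l i') - u s i' else 0))"
    unfolding mult_0 mult_1 add_0
    by (rule A_mat_mult_vec[OF m_pos n_pos assms(4)])
      (use A in \<open>simp_all only: A_mat_transpose_mult_vec[OF m_pos n_pos] y dim_mult_mat_vec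
        index_transpose_mat carrier_matD\<close>)
  also have "\<dots> = (if a = 0 then r\<^sub>1 k i else if a = 1 then r\<^sub>2 k i else r\<^sub>3 k i)"
  proof -
    \<comment> \<open>In the third block the bound on the row index excludes the corner, so the
      \<open>if\<close> reduces to \<open>w\<close> and \<open>equation_3\<close> applies.\<close>
    have "\<not> (k = n - 1 \<and> i = m - 1)" if "a = 2"
      using assms(4) that third_block_pos_less_iff[OF assms(2,3)] by simp
    then show ?thesis
      unfolding sum_grid_delta[OF assms(2,3)]
      using assms(1,3) equation_1[of i k] equation_2[of k i] equation_3[of k i] by auto
  qed
  finally show ?thesis .
qed

theorem corollary1:
  shows "\<exists>(p :: prog) (C :: real). \<forall>(m :: nat) (n :: nat) (R :: real vec).
           0 < m \<longrightarrow> 0 < n \<longrightarrow> R \<in> carrier_vec (M3 m n) \<longrightarrow>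
           (\<exists>(y :: real vec) (flops :: nat).
              computes p m n R y flops \<and>
              y \<in> carrier_vec (M3 m n) \<and>
              (A_mat m n * transpose_mat (A_mat m n)) *\<^sub>v y = R \<and>
              real flops \<le> C * real (M3 m n))"
proof (intro exI[of _ solver] exI[of _ "27 :: real"] allI impI)
  fix m n :: nat and R :: "real vec"
  assume mn: "0 < m" "0 < n" and R: "R \<in> carrier_vec (M3 m n)"
  \<comment> \<open>\<open>f\<close> agrees with the initial \<open>Input\<close> array. It vanishes
    at \<open>M3 m n\<close>, the first index outside \<open>R\<close>, which gives
    \<open>corner\<close>.\<close>
  define f where "f x = (if x < dim_vec R then R $ x else 0)" for x
  interpret grid_system m n "\<lambda>k i. f (k * m + i)" "\<lambda>k i. f (m * n + (k * m + i))"
    "\<lambda>k i. f (2 * (m * n) + (k * m + i))"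
    using mn R third_block_pos_less_iff[of "n - 1" n "m - 1" m]
    by unfold_locales (simp_all add: f_def)
  obtain \<mu> c where run: "runs solver (init_index m n) (init_memory m n R) \<mu> c"
    and c: "c \<le> 27 * (m * n)" and out: "\<And>x. x < 3 * (m * n) \<Longrightarrow> \<mu> Output x = y x"
    by (rule runs_solver[of "init_memory m n R"]) (auto simp: init_memory_def f_def)
  let ?A = "A_mat m n" and ?y = "vec (M3 m n) y"
  have "computes solver m n R ?y c"
    using run out by (auto simp: computes_def runs_def M3_def)
  moreover have "(?A * transpose_mat ?A) *\<^sub>v ?y = R"
  proof (rule eq_vecI)
    fix x assume "x < dim_vec R"
    then have x: "x < M3 m n" using R by simp
    define a k i where "a = x div (m * n)" and "k = x mod (m * n) div m" and "i = x mod m"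
    have k: "k < n"
      unfolding k_def using mn by (intro less_mult_imp_div_less) (simp add: mult.commute[of n])
    have i: "i < m"
      unfolding i_def using mn by simp
    have "a < 3"
      unfolding a_def using x by (intro less_mult_imp_div_less) (simp add: M3_def)
    then have a: "a = 0 \<or> a = 1 \<or> a = 2"
      by linarith
    \<comment> \<open>Reducing modulo \<open>m * n\<close> first does not change the remainder
      modulo \<open>m\<close>, since \<open>m\<close> divides \<open>m * n\<close>.\<close>
    have "k * m + i = x mod (m * n)"
      unfolding k_def i_def by (metis div_mult_mod_eq mod_mod_cancel dvd_triv_left)
    then have x_eq: "x = a * (m * n) + (k * m + i)"
      unfolding a_def by (simp only: div_mult_mod_eq)
    have "((?A * transpose_mat ?A) *\<^sub>v ?y) $ x = f x"
      using normal_equations[OF \<open>a < 3\<close> k i] x a unfolding x_eq by auto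
    then show "((?A * transpose_mat ?A) *\<^sub>v ?y) $ x = R $ x"
      using \<open>x < dim_vec R\<close> by (simp add: f_def)
  qed (use A_mat_carrier[OF mn] R in simp)
  \<comment> \<open>As \<open>m * n\<close> is at least \<open>1\<close>, it is at most
    \<open>3 * (m * n) - 1\<close>, so the constant \<open>27\<close> carries over.\<close>
  moreover have "c \<le> 27 * M3 m n"
    using c mn by (intro order.trans[OF c] mult_le_mono2) (simp add: M3_def)
  then have "real c \<le> 27 * real (M3 m n)"
    by (metis of_nat_le_iff of_nat_mult of_nat_numeral)
  ultimately show "\<exists>y flops. computes solver m n R y flops \<and> y \<in> carrier_vec (M3 m n) \<and>
      (?A * transpose_mat ?A) *\<^sub>v y = R \<and> real flops \<le> 27 * real (M3 m n)"
    by (intro exI[of _ ?y] exI[of _ c]) simp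
qed

end
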